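(* Let $\Lambda$ be an $n$-dimensional lattice. All co-cyclic sublattices of $\Lambda$ with the same index are unimodular equivalent; that is, if $\Lambda^*$ and $\Lambda^\bullet$ are co-cyclic sublattices of $\Lambda$ with $[\Lambda:\Lambda^*]=[\Lambda:\Lambda^\bullet]$, then $\Lambda^*$ and $\Lambda^\bullet$ are unimodular equivalent.
   Context: An $n$-dimensional lattice is the $\mathbb{Z}$-span of $n$ linearly independent vectors in a Euclidean space; a sublattice of $\Lambda$ is a subset of $\Lambda$ which is itself an $n$-dimensional lattice. A sublattice $\Lambda^*$ of $\Lambda$ is co-cyclic if the quotient group $\Lambda/\Lambda^*$ is a finite cyclic group. Two sublattices $\Lambda^*$ and $\Lambda^\bullet$ of $\Lambda$ are unimodular equivalent if there exists a linear transformation $\sigma$ such that $\Lambda=\sigma(\Lambda)$ and $\Lambda^\bullet=\sigma(\Lambda^* )$. *)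

theory Defs
  imports "HOL-Analysis.Analysis" "HOL-Algebra.Elementary_Groups"
begin

text \<open>The dimension \<open>n\<close> may be smaller than the dimension of the ambient Euclidean space.\<close>

definition is_lattice :: "nat \<Rightarrow> 'a::euclidean_space set \<Rightarrow> bool" where
  "is_lattice n L \<longleftrightarrow>
     (\<exists>B. finite B \<and> card B = n \<and> independent B \<and>
          L = range (\<lambda>c :: 'a \<Rightarrow> int. \<Sum>b\<in>B. of_int (c b) *\<^sub>R b))"

definition is_sublattice :: "nat \<Rightarrow> 'a::euclidean_space set \<Rightarrow> 'a set \<Rightarrow> bool" where
  "is_sublattice n M L \<longleftrightarrow> M \<subseteq> L \<and> is_lattice n M"

definition additive_group :: "'a::ab_group_add set \<Rightarrow> 'a monoid" where
  "additive_group L = \<lparr>carrier = L, monoid.mult = (+), one = 0\<rparr>"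

definition lattice_index :: "'a::ab_group_add set \<Rightarrow> 'a set \<Rightarrow> nat" where
  "lattice_index L M = order (additive_group L Mod M)"

definition cocyclic_sublattice :: "nat \<Rightarrow> 'a::euclidean_space set \<Rightarrow> 'a set \<Rightarrow> bool" where
  "cocyclic_sublattice n M L \<longleftrightarrow>
     is_sublattice n M L \<and>
     finite (carrier (additive_group L Mod M)) \<and>
     cyclic_group (additive_group L Mod M)"

text \<open>
  The transformation is a linear map of the whole ambient space. The condition \<open>L = \<sigma> ` L\<close>
  makes it bijective on the real span of \<open>L\<close>; its behaviour off that span is irrelevant.
\<close>

definition unimodular_equivalent :: "'a::euclidean_space set \<Rightarrow> 'a set \<Rightarrow> 'a set \<Rightarrow> bool" where
  "unimodular_equivalent L M N \<longleftrightarrow>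
     (\<exists>\<sigma> :: 'a \<Rightarrow> 'a. linear \<sigma> \<and> L = \<sigma> ` L \<and> N = \<sigma> ` M)"

end

theory Submission
  imports Defs "HOL-Algebra.Multiplicative_Group"
begin

text \<open>
  The theorem holds because a co-cyclic sublattice of index \<open>m\<close> has a normal form: \<open>L\<close> has a
  \<open>\<int>\<close>-basis with a distinguished member \<open>e\<close> such that the sublattice consists of exactly those
  vectors whose \<open>e\<close>-coordinate is divisible by \<open>m\<close>
  (\<open>cocyclic_sublattice_normal_form\<close>). A linear map that carries such a basis for \<open>M\<close> to one for
  \<open>N\<close>, distinguished member to distinguished member, preserves \<open>L\<close> and maps \<open>M\<close> onto \<open>N\<close>.

  For the normal form, let the coset of \<open>g\<close> generate \<open>L / M\<close>. Each vector \<open>b\<close> of a basis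
  lies in the coset of some integer multiple \<open>a b\<close> of \<open>g\<close>, and the linear functional \<open>F\<close> with
  \<open>F b = a b\<close> then describes \<open>M\<close> as \<open>{x \<in> L. m dvd F x}\<close>, with \<open>F g\<close> congruent to 1 modulo \<open>m\<close>
  (\<open>cyclic_quotient_functional\<close>). Euclid's algorithm, carried out on bases of \<open>L\<close>
  instead of on numbers, yields a basis on which \<open>F\<close> vanishes except at one member \<open>e\<close>
  (\<open>basis_concentrating_functional\<close>). The value at \<open>e\<close> then divides \<open>F g\<close>, so it is a unit
  modulo \<open>m\<close>, and \<open>m dvd F x\<close> only says that \<open>m\<close> divides the \<open>e\<close>-coordinate of \<open>x\<close>.
\<close>

section \<open>Integral bases\<close>

definition int_comb :: "'a::euclidean_space set \<Rightarrow> ('a \<Rightarrow> int) \<Rightarrow> 'a" where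
  "int_comb B c = (\<Sum>b\<in>B. of_int (c b) *\<^sub>R b)"

definition int_basis :: "'a::euclidean_space set \<Rightarrow> 'a set \<Rightarrow> bool" where
  "int_basis B L \<longleftrightarrow> finite B \<and> independent B \<and> L = range (int_comb B)"

lemma is_lattice_iff_int_basis: "is_lattice n L \<longleftrightarrow> (\<exists>B. int_basis B L \<and> card B = n)"
  unfolding is_lattice_def int_basis_def int_comb_def[abs_def] by blast

lemma int_comb_diff: "int_comb B c - int_comb B d = int_comb B (\<lambda>b. c b - d b)"
  by (simp add: int_comb_def sum_subtractf scaleR_diff_left)

lemma int_comb_unit:
  assumes "finite B" "b \<in> B"
  shows "int_comb B (\<lambda>x. if x = b then 1 else 0) = b"
proof -
  have "int_comb B (\<lambda>x. if x = b then 1 else 0) = (\<Sum>x\<in>B. if x = b then x else 0)"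
    unfolding int_comb_def by (intro sum.cong) auto
  with assms show ?thesis by simp
qed

lemma linear_int_comb: "linear F \<Longrightarrow> F (int_comb B c) = (\<Sum>b\<in>B. of_int (c b) *\<^sub>R F b)"
  by (simp add: int_comb_def linear_sum linear_cmul)

lemma int_comb_in_span: "int_comb B c \<in> span B"
  unfolding int_comb_def by (intro span_sum span_scale span_base)

lemma diff_closed_imp_int_scaleR_closed:
  fixes S :: "'a::real_vector set"
  assumes "0 \<in> S" and diff: "\<And>x y. x \<in> S \<Longrightarrow> y \<in> S \<Longrightarrow> x - y \<in> S" and "x \<in> S"
  shows "of_int k *\<^sub>R x \<in> S"
proof -
  have neg: "- y \<in> S" if "y \<in> S" for y
    using diff[OF assms(1) that] by simp
  have nat: "of_nat j *\<^sub>R x \<in> S" for j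
  proof (induction j)
    case (Suc j)
    show ?case
      using diff[OF Suc neg[OF \<open>x \<in> S\<close>]] by (simp add: algebra_simps)
  qed (use assms in simp)
  show ?thesis
  proof (cases k)
    case (nonneg j)
    then show ?thesis using nat[of j] by simp
  next
    case (neg j)
    have "of_int k *\<^sub>R x = - (of_nat (Suc j) *\<^sub>R x)"
      unfolding neg by (metis of_int_minus of_int_of_nat_eq scaleR_minus_left)
    then show ?thesis using \<open>\<And>y. y \<in> S \<Longrightarrow> - y \<in> S\<close>[OF nat[of "Suc j"]] by metis
  qed
qed

lemma int_sum_in_diff_closed:
  fixes S :: "'a::real_vector set"
  assumes zero: "0 \<in> S" and diff: "\<And>x y. x \<in> S \<Longrightarrow> y \<in> S \<Longrightarrow> x - y \<in> S"
    and f: "\<And>b. b \<in> B \<Longrightarrow> f b \<in> S"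
  shows "(\<Sum>b\<in>B. of_int (c b) *\<^sub>R f b) \<in> S"
proof -
  have add: "x + y \<in> S" if "x \<in> S" "y \<in> S" for x y
    using diff[OF that(1) diff[OF zero that(2)]] by simp
  show ?thesis
    using f
  proof (induction B rule: infinite_finite_induct)
    case (insert a A)
    then have "of_int (c a) *\<^sub>R f a \<in> S"
      using diff_closed_imp_int_scaleR_closed[OF zero diff] by blast
    with insert add show ?case by simp
  qed (use zero in auto)
qed

lemma int_comb_in_diff_closed:
  assumes "0 \<in> S" and "\<And>x y. x \<in> S \<Longrightarrow> y \<in> S \<Longrightarrow> x - y \<in> S" and "B \<subseteq> S"
  shows "int_comb B c \<in> S"
  unfolding int_comb_def using assms by (intro int_sum_in_diff_closed) auto

lemma int_basis_subset: "int_basis B L \<Longrightarrow> B \<subseteq> L"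
  unfolding int_basis_def by (metis int_comb_unit rangeI subsetI)

lemma int_basis_zero: "int_basis B L \<Longrightarrow> 0 \<in> L"
  unfolding int_basis_def
  by (metis (no_types, lifting) int_comb_diff cancel_comm_monoid_add_class.diff_cancel rangeI)

lemma int_basis_diff: "int_basis B L \<Longrightarrow> x \<in> L \<Longrightarrow> y \<in> L \<Longrightarrow> x - y \<in> L"
  unfolding int_basis_def by (auto simp: int_comb_diff)

lemma int_basis_card: "int_basis B L \<Longrightarrow> card B = dim L"
proof -
  assume B: "int_basis B L"
  have "L \<subseteq> span B"
    using B int_comb_in_span unfolding int_basis_def by blast
  then show ?thesis
    using B dim_unique[OF int_basis_subset[OF B] _ _ refl] unfolding int_basis_def by metis
qed

text \<open>
  The elementary move of Euclid's algorithm. The new family still generates, and it has no more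
  members than \<open>B\<close>, so a dimension count gives its independence.
\<close>
lemma int_basis_replace:
  fixes k :: int
  assumes B: "int_basis B L" and b: "b \<in> B" "b' \<in> B" "b \<noteq> b'"
  shows "int_basis (insert (b - of_int k *\<^sub>R b') (B - {b})) L"
proof -
  define x where "x = b - of_int k *\<^sub>R b'"
  define B' where "B' = insert x (B - {b})"
  have fin: "finite B" and ind: "independent B" and L: "L = range (int_comb B)"
    using B by (auto simp: int_basis_def)
  have fin': "finite B'" using fin by (simp add: B'_def)
  have zero: "0 \<in> L" and diff: "\<And>x y. x \<in> L \<Longrightarrow> y \<in> L \<Longrightarrow> x - y \<in> L"
    using int_basis_zero[OF B] int_basis_diff[OF B] by auto
  have scale: "of_int j *\<^sub>R y \<in> L" if "y \<in> L" for j y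
    using diff_closed_imp_int_scaleR_closed[of L y j] zero diff that by blast
  have "B' \<subseteq> L"
    using int_basis_subset[OF B] b diff[of b, OF _ scale[of b' k]] by (auto simp: B'_def x_def)
  then have 1: "range (int_comb B') \<subseteq> L"
    using int_comb_in_diff_closed[of L B'] zero diff by blast
  have zero': "0 \<in> range (int_comb B')"
    by (rule range_eqI[of _ _ "\<lambda>_. 0"]) (simp add: int_comb_def)
  have diff': "u - v \<in> range (int_comb B')"
    if "u \<in> range (int_comb B')" "v \<in> range (int_comb B')" for u v
    using that int_comb_diff[of B'] by auto
  have mem': "u \<in> range (int_comb B')" if "u \<in> B'" for u
    using int_comb_unit[OF fin' that] by (metis rangeI)
  have "b' \<in> B'" using b by (simp add: B'_def)
  have "x - of_int (- k) *\<^sub>R b' \<in> range (int_comb B')"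
  proof (rule diff')
    show "x \<in> range (int_comb B')" by (rule mem') (simp add: B'_def)
    show "of_int (- k) *\<^sub>R b' \<in> range (int_comb B')"
      by (rule diff_closed_imp_int_scaleR_closed[OF zero' diff' mem'[OF \<open>b' \<in> B'\<close>]])
  qed
  then have "b \<in> range (int_comb B')" by (simp add: x_def)
  then have "B \<subseteq> range (int_comb B')"
    using mem' by (auto simp: B'_def)
  then have 2: "L \<subseteq> range (int_comb B')"
    using int_comb_in_diff_closed[of "range (int_comb B')" B] zero' diff' L by blast
  have "card B' \<le> card B"
    using fin b by (metis B'_def card_Diff_singleton card_insert_le_m1 card_gt_0_iff empty_iff order_refl)
  moreover have "L \<subseteq> span B'"
    using 2 int_comb_in_span by blast
  ultimately have "independent B'"
    using card_le_dim_spanning[OF \<open>B' \<subseteq> L\<close> _ fin'] int_basis_card[OF B] by simp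
  with 1 2 fin' show ?thesis by (auto simp: int_basis_def B'_def x_def)
qed

text \<open>
  Euclid's algorithm on a basis: as long as \<open>F\<close> is nonzero at two members, subtracting
  from the one with the larger value plus or minus the other lowers \<open>\<Sum>\<bar>F b\<bar>\<close>.
\<close>
lemma basis_concentrating_functional:
  fixes F :: "'a::euclidean_space \<Rightarrow> real"
  assumes F: "linear F" "F ` L \<subseteq> \<int>" and B: "int_basis B L" "B \<noteq> {}"
  shows "\<exists>E e. int_basis E L \<and> e \<in> E \<and> (\<forall>b\<in>E - {e}. F b = 0)"
  using B
proof (induction "nat \<lfloor>\<Sum>b\<in>B. \<bar>F b\<bar>\<rfloor>" arbitrary: B rule: less_induct)
  case less
  have fin: "finite B" using less.prems by (simp add: int_basis_def)
  have int: "F b \<in> \<int>" if "b \<in> B" for b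
    using that F(2) int_basis_subset[OF less.prems(1)] by blast
  show ?case
  proof (cases "\<exists>b\<in>B. \<exists>b'\<in>B. b \<noteq> b' \<and> F b \<noteq> 0 \<and> F b' \<noteq> 0")
    case False
    then show ?thesis using less.prems
      by (metis DiffD1 DiffD2 all_not_in_conv singletonI)
  next
    case True
    then obtain b b' where b: "b \<in> B" "b' \<in> B" "b \<noteq> b'" "F b \<noteq> 0" "F b' \<noteq> 0"
      and le: "\<bar>F b'\<bar> \<le> \<bar>F b\<bar>"
      by (metis linear)
    \<comment> \<open>With this sign, \<open>F b\<close> and \<open>k * F b'\<close> have equal signs, so the subtraction shrinks \<open>\<bar>F b\<bar>\<close>.\<close>
    define k :: int where "k = (if F b * F b' > 0 then 1 else - 1)"
    define x where "x = b - of_int k *\<^sub>R b'"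
    define B' where "B' = insert x (B - {b})"
    have basis: "int_basis B' L"
      unfolding B'_def x_def by (rule int_basis_replace) (use less.prems b in auto)
    have Fx: "F x = F b - of_int k * F b'"
      unfolding x_def using F(1) by (simp add: linear_diff linear_cmul)
    have "\<bar>F x\<bar> < \<bar>F b\<bar>"
      unfolding Fx k_def using b le by (auto simp: zero_less_mult_iff split: if_splits)
    moreover have "(\<Sum>u\<in>B'. \<bar>F u\<bar>) \<le> \<bar>F x\<bar> + (\<Sum>u\<in>B - {b}. \<bar>F u\<bar>)"
      using fin by (simp add: B'_def sum.insert_if)
    moreover have "(\<Sum>u\<in>B. \<bar>F u\<bar>) = \<bar>F b\<bar> + (\<Sum>u\<in>B - {b}. \<bar>F u\<bar>)"
      using fin b by (simp add: sum.remove)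
    ultimately have lt: "(\<Sum>u\<in>B'. \<bar>F u\<bar>) < (\<Sum>u\<in>B. \<bar>F u\<bar>)" by linarith
    have "(\<Sum>u\<in>B. \<bar>F u\<bar>) \<in> \<int>"
      using int by (intro Ints_sum Ints_abs)
    then have "\<lfloor>\<Sum>u\<in>B'. \<bar>F u\<bar>\<rfloor> < \<lfloor>\<Sum>u\<in>B. \<bar>F u\<bar>\<rfloor>"
      using lt by (metis Ints_cases floor_less_iff floor_of_int)
    moreover have "0 \<le> \<lfloor>\<Sum>u\<in>B'. \<bar>F u\<bar>\<rfloor>" by (simp add: sum_nonneg)
    ultimately have "nat \<lfloor>\<Sum>u\<in>B'. \<bar>F u\<bar>\<rfloor> < nat \<lfloor>\<Sum>u\<in>B. \<bar>F u\<bar>\<rfloor>" by linarith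
    from less.hyps[OF this basis] show ?thesis by (simp add: B'_def)
  qed
qed

section \<open>Quotients of lattices\<close>

lemma additive_group_simps [simp]:
  "carrier (additive_group L) = L"
  "x \<otimes>\<^bsub>additive_group L\<^esub> y = x + y"
  "\<one>\<^bsub>additive_group L\<^esub> = 0"
  by (simp_all add: additive_group_def)

lemma comm_group_additive_group:
  fixes L :: "'a::ab_group_add set"
  assumes zero: "0 \<in> L" and diff: "\<And>x y. x \<in> L \<Longrightarrow> y \<in> L \<Longrightarrow> x - y \<in> L"
  shows "comm_group (additive_group L)"
proof (rule comm_groupI)
  show "\<exists>y\<in>carrier (additive_group L). y \<otimes>\<^bsub>additive_group L\<^esub> x = \<one>\<^bsub>additive_group L\<^esub>"
    if "x \<in> carrier (additive_group L)" for x
    using that diff[OF zero, of x] by (intro bexI[of _ "- x"]) auto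
  show "x \<otimes>\<^bsub>additive_group L\<^esub> y \<in> carrier (additive_group L)"
    if "x \<in> carrier (additive_group L)" "y \<in> carrier (additive_group L)" for x y
    using that diff[of x "- y"] diff[OF zero, of y] by auto
qed (use zero in \<open>auto simp: algebra_simps\<close>)

lemma inv_additive_group:
  fixes L :: "'a::ab_group_add set"
  assumes "0 \<in> L" "\<And>x y. x \<in> L \<Longrightarrow> y \<in> L \<Longrightarrow> x - y \<in> L" "x \<in> L"
  shows "inv\<^bsub>additive_group L\<^esub> x = - x"
proof -
  interpret comm_group "additive_group L" using assms comm_group_additive_group by blast
  show ?thesis
    using assms(2)[OF assms(1,3)] assms(3) by (intro inv_equality) auto
qed

lemma int_pow_additive_group:
  fixes L :: "'a::real_vector set" and k :: int
  assumes "0 \<in> L" "\<And>x y. x \<in> L \<Longrightarrow> y \<in> L \<Longrightarrow> x - y \<in> L" "x \<in> L"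
  shows "x [^]\<^bsub>additive_group L\<^esub> k = of_int k *\<^sub>R x"
proof -
  interpret comm_group "additive_group L" using assms comm_group_additive_group by blast
  have nat: "x [^]\<^bsub>additive_group L\<^esub> j = of_nat j *\<^sub>R x" for j :: nat
    by (induction j) (auto simp: algebra_simps)
  have "of_int j *\<^sub>R x \<in> L" for j
    using diff_closed_imp_int_scaleR_closed[of L x j] assms by blast
  from inv_additive_group[OF assms(1,2) this[of "- k"]] show ?thesis
    by (simp add: int_pow_def2 nat)
qed

lemma subgroup_additive_group:
  fixes L :: "'a::ab_group_add set"
  assumes "0 \<in> L" "\<And>x y. x \<in> L \<Longrightarrow> y \<in> L \<Longrightarrow> x - y \<in> L"
    and "M \<subseteq> L" "0 \<in> M" "\<And>x y. x \<in> M \<Longrightarrow> y \<in> M \<Longrightarrow> x - y \<in> M"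
  shows "subgroup M (additive_group L)"
proof
  show "x \<otimes>\<^bsub>additive_group L\<^esub> y \<in> M" if "x \<in> M" "y \<in> M" for x y
    using assms(5)[OF that(1) assms(5)[OF assms(4) that(2)]] by simp
  show "inv\<^bsub>additive_group L\<^esub> x \<in> M" if "x \<in> M" for x
    using that assms(3) assms(5)[OF assms(4) that] inv_additive_group[OF assms(1,2), of x] by auto
qed (use assms in auto)

text \<open>
  Writing the coset of \<open>x\<close> as a multiple of a generating coset determines the multiplier modulo
  the index only, so it is not additive in \<open>x\<close> as an integer. Fixing integer multipliers on a
  basis and extending linearly gives \<open>F\<close>. Then \<open>x - F x *\<^sub>R g\<close> lies in \<open>M\<close> for all \<open>x \<in> L\<close>, being
  an integer combination of such differences for basis vectors; so \<open>x\<close> lies in \<open>M\<close> iff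
  \<open>F x *\<^sub>R g\<close> does, and the order of the coset of \<open>g\<close> decides that. An infinite quotient has
  index 0 and a generator of order 0 by the library conventions, which agree.
\<close>
lemma cyclic_quotient_functional:
  fixes L M :: "'a::euclidean_space set"
  assumes B: "int_basis B L" and M: "M \<subseteq> L" "int_basis C M"
    and cyc: "cyclic_group (additive_group L Mod M)"
  obtains F :: "'a \<Rightarrow> real" and g
  where "linear F" "F ` L \<subseteq> \<int>" "g \<in> L"
    "\<And>x k. x \<in> L \<Longrightarrow> F x = of_int k \<Longrightarrow> x \<in> M \<longleftrightarrow> int (lattice_index L M) dvd k"
    "\<And>k. F g = of_int k \<Longrightarrow> int (lattice_index L M) dvd k - 1"
proof -
  define m where "m = lattice_index L M"
  let ?G = "additive_group L"
  note zero = int_basis_zero[OF B] and diff = int_basis_diff[OF B]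
  note zeroM = int_basis_zero[OF M(2)] and diffM = int_basis_diff[OF M(2)]
  interpret G: comm_group ?G by (rule comm_group_additive_group[OF zero diff])
  have sub: "subgroup M ?G"
    by (rule subgroup_additive_group[OF zero diff M(1) zeroM diffM])
  interpret M: normal M ?G using sub by (rule G.subgroup_imp_normal)
  interpret Q: group "?G Mod M" by (rule M.factorgroup_is_group)
  obtain q where q: "q \<in> carrier (?G Mod M)" "subgroup_generated (?G Mod M) {q} = ?G Mod M"
    using cyc by (auto simp: cyclic_group_def)
  obtain g where g: "g \<in> L" and qg: "q = M #>\<^bsub>?G\<^esub> g"
    using q(1) by (auto simp: carrier_FactGroup)
  have ord: "group.ord (?G Mod M) q = m"
    using Q.cyclic_order_is_ord[OF q(1)] q(2) by (simp add: m_def lattice_index_def)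
  have pow: "q [^]\<^bsub>?G Mod M\<^esub> k = M #>\<^bsub>?G\<^esub> (of_int k *\<^sub>R g)" for k :: int
    using M.FactGroup_int_pow[of g k] g int_pow_additive_group[OF zero diff g] by (simp add: qg)
  have scale: "of_int k *\<^sub>R g \<in> L" for k
    using diff_closed_imp_int_scaleR_closed[of L g k] zero diff g by blast
  have mult_g: "of_int k *\<^sub>R g \<in> M \<longleftrightarrow> int m dvd k" for k
    using Q.int_pow_eq_id[OF q(1), of k] scale[of k] sub
      G.coset_join1[of M "of_int k *\<^sub>R g"] G.coset_join2[of "of_int k *\<^sub>R g" M]
    by (auto simp: pow ord)
  have "\<exists>k::int. x - of_int k *\<^sub>R g \<in> M" if x: "x \<in> L" for x
  proof -
    have "M #>\<^bsub>?G\<^esub> x \<in> range (\<lambda>k::int. q [^]\<^bsub>?G Mod M\<^esub> k)"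
      using Q.carrier_subgroup_generated_by_singleton[OF q(1)] q(2) x
      by (auto simp: carrier_FactGroup)
    then obtain k where k: "M #>\<^bsub>?G\<^esub> x = M #>\<^bsub>?G\<^esub> (of_int k *\<^sub>R g)"
      by (auto simp: pow)
    have "x \<in> M #>\<^bsub>?G\<^esub> x" using G.rcos_self[of x M] x sub by simp
    then obtain y where "y \<in> M" "x = y + of_int k *\<^sub>R g"
      unfolding k by (auto simp: r_coset_def)
    then show ?thesis by (intro exI[of _ k]) simp
  qed
  then obtain a :: "'a \<Rightarrow> int" where a: "\<And>x. x \<in> L \<Longrightarrow> x - of_int (a x) *\<^sub>R g \<in> M"
    by metis
  have "independent B" using B by (simp add: int_basis_def)
  then obtain F :: "'a \<Rightarrow> real" where F: "linear F" "\<And>b. b \<in> B \<Longrightarrow> F b = of_int (a b)"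
    using linear_independent_extend[of B "\<lambda>b. of_int (a b) :: real"] by metis
  have F_comb: "F (int_comb B c) = of_int (\<Sum>b\<in>B. c b * a b)" for c
    using F by (simp add: linear_int_comb)
  \<comment> \<open>Only now does \<open>F x\<close> become a valid multiplier for every \<open>x \<in> L\<close>, not just for \<open>x \<in> B\<close>.\<close>
  have red: "x - F x *\<^sub>R g \<in> M" if "x \<in> L" for x
  proof -
    obtain c where x: "x = int_comb B c" using \<open>x \<in> L\<close> B unfolding int_basis_def by blast
    have "x - F x *\<^sub>R g = (\<Sum>b\<in>B. of_int (c b) *\<^sub>R (b - of_int (a b) *\<^sub>R g))"
      unfolding x F_comb
      by (simp add: int_comb_def scaleR_diff_right sum_subtractf scaleR_sum_left)
    also have "\<dots> \<in> M"
      by (rule int_sum_in_diff_closed[OF zeroM diffM]) (use a int_basis_subset[OF B] in auto)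
    finally show ?thesis .
  qed
  show ?thesis
  proof (rule that[OF F(1) _ g])
    show "F ` L \<subseteq> \<int>" using B by (auto simp: int_basis_def F_comb simp del: of_int_sum of_int_mult)
    show "x \<in> M \<longleftrightarrow> int (lattice_index L M) dvd k" if "x \<in> L" "F x = of_int k" for x k
    proof -
      have r: "x - of_int k *\<^sub>R g \<in> M" using red[OF that(1)] that(2) by simp
      have "x \<in> M \<longleftrightarrow> of_int k *\<^sub>R g \<in> M"
        using diffM[OF _ r, of x] diffM[OF r diffM[OF zeroM, of "of_int k *\<^sub>R g"]] by auto
      then show ?thesis using mult_g by (simp add: m_def)
    qed
    show "int (lattice_index L M) dvd k - 1" if "F g = of_int k" for k
    proof -
      have "of_int (1 - k) *\<^sub>R g \<in> M" using red[OF g] that by (simp add: algebra_simps)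
      then show ?thesis using mult_g dvd_diff_commute by (metis m_def)
    qed
  qed
qed

section \<open>Normal form and equivalence\<close>

text \<open>
  Seen in a suitable basis, \<open>M\<close> depends on its index only. For the basis found by
  Euclid's algorithm, \<open>F x\<close> is the \<open>e\<close>-coordinate of \<open>x\<close> times \<open>F e\<close>; taking \<open>x = g\<close> shows that
  \<open>F e\<close> is coprime to the index and can be cancelled.
\<close>
lemma cocyclic_sublattice_normal_form:
  fixes L M :: "'a::euclidean_space set"
  assumes B: "int_basis B L" "B \<noteq> {}" and M: "M \<subseteq> L" "int_basis C M"
    and cyc: "cyclic_group (additive_group L Mod M)"
  obtains E e where "int_basis E L" "e \<in> E"
    "M = int_comb E ` {c. int (lattice_index L M) dvd c e}"
proof -
  define m where "m = int (lattice_index L M)"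
  obtain F :: "'a \<Rightarrow> real" and g where F: "linear F" "F ` L \<subseteq> \<int>" and g: "g \<in> L"
    and mem: "\<And>x k. x \<in> L \<Longrightarrow> F x = of_int k \<Longrightarrow> x \<in> M \<longleftrightarrow> m dvd k"
    and Fg: "\<And>k. F g = of_int k \<Longrightarrow> m dvd k - 1"
    using cyclic_quotient_functional[OF B(1) M cyc] unfolding m_def by metis
  obtain E e where E: "int_basis E L" "e \<in> E" and zero: "\<forall>b\<in>E - {e}. F b = 0"
    using basis_concentrating_functional[OF F B] by blast
  have fin: "finite E" and L: "L = range (int_comb E)" using E by (auto simp: int_basis_def)
  obtain u :: int where u: "F e = of_int u"
    using F(2) E int_basis_subset by (metis Ints_cases image_subset_iff subsetD)
  have F_comb: "F (int_comb E c) = of_int (c e * u)" for c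
    using fin E(2) zero by (simp add: linear_int_comb[OF F(1)] sum.remove u)
  obtain d where "g = int_comb E d" using g L by blast
  then have "m dvd d e * u - 1" using Fg F_comb by blast
  have "coprime m u"
  proof (rule coprimeI)
    fix k assume k: "k dvd m" "k dvd u"
    then have "k dvd d e * u - (d e * u - 1)"
      using \<open>m dvd d e * u - 1\<close> by (meson dvd_diff dvd_mult dvd_trans)
    then show "is_unit k" by simp
  qed
  then have "int_comb E c \<in> M \<longleftrightarrow> m dvd c e" for c
    using mem[of "int_comb E c" "c e * u"] L F_comb by (simp add: coprime_dvd_mult_left_iff)
  then have "M = int_comb E ` {c. m dvd c e}" using M(1) L by auto
  then show ?thesis by (intro that[OF E]) (simp only: m_def)
qed

lemma linear_image_int_comb:
  assumes s: "linear s" "\<And>b. b \<in> E \<Longrightarrow> s b = h b" and h: "bij_betw h E E'"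
  shows "s (int_comb E (c \<circ> h)) = int_comb E' c"
proof -
  have "s (int_comb E (c \<circ> h)) = (\<Sum>b\<in>E. of_int (c (h b)) *\<^sub>R h b)"
    using s by (simp add: linear_int_comb)
  also have "\<dots> = int_comb E' c"
    unfolding int_comb_def by (rule sum.reindex_bij_betw[OF h])
  finally show ?thesis .
qed

theorem theorem5p1:
  fixes n :: nat and L M N :: "'a::euclidean_space set"
  assumes "is_lattice n L"
    and "cocyclic_sublattice n M L"
    and "cocyclic_sublattice n N L"
    and "lattice_index L M = lattice_index L N"
  shows "unimodular_equivalent L M N"
proof -
  obtain B where B: "int_basis B L"
    using assms(1) by (auto simp: is_lattice_iff_int_basis)
  obtain C where M: "M \<subseteq> L" "int_basis C M"
    and cycM: "cyclic_group (additive_group L Mod M)"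
    using assms(2) by (auto simp: cocyclic_sublattice_def is_sublattice_def is_lattice_iff_int_basis)
  obtain D where N: "N \<subseteq> L" "int_basis D N"
    and cycN: "cyclic_group (additive_group L Mod N)"
    using assms(3) by (auto simp: cocyclic_sublattice_def is_sublattice_def is_lattice_iff_int_basis)
  show ?thesis
  proof (cases "B = {}")
    case True
    then have "L = {0}" using B by (auto simp: int_basis_def int_comb_def)
    then have "M = {0}" "N = {0}" using M N int_basis_zero by blast+
    then show ?thesis unfolding unimodular_equivalent_def
      by (intro exI[of _ id]) (auto intro: linear_id)
  next
    case False
    define m where "m = int (lattice_index L M)"
    obtain E e where E: "int_basis E L" "e \<in> E" and ME: "M = int_comb E ` {c. m dvd c e}"
      using cocyclic_sublattice_normal_form[OF B False M cycM] unfolding m_def by metis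
    obtain E' e' where E': "int_basis E' L" "e' \<in> E'" and NE: "N = int_comb E' ` {c. m dvd c e'}"
      using cocyclic_sublattice_normal_form[OF B False N cycN] unfolding m_def assms(4) by metis
    have fin: "finite E" "finite E'" and ind: "independent E"
      and L: "L = range (int_comb E)" "L = range (int_comb E')"
      using E(1) E'(1) by (auto simp: int_basis_def)
    have "card (E - {e}) = card (E' - {e'})"
      using fin E E' int_basis_card by (metis card_Diff_singleton)
    then obtain h0 where h0: "bij_betw h0 (E - {e}) (E' - {e'})"
      using fin finite_same_card_bij[of "E - {e}" "E' - {e'}"] by auto
    define h where "h = h0(e := e')"
    have "bij_betw h (E - {e}) (E' - {e'})"
      using h0 by (rule bij_betw_cong[THEN iffD1, rotated]) (simp add: h_def)
    then have "bij_betw h (insert e (E - {e})) (insert e' (E' - {e'}))"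
      using notIn_Un_bij_betw[of e "E - {e}" h "E' - {e'}"] by (simp add: h_def)
    then have h: "bij_betw h E E'" and he: "h e = e'"
      using E E' by (simp_all add: insert_absorb h_def)
    obtain s :: "'a \<Rightarrow> 'a" where s: "linear s" "\<And>b. b \<in> E \<Longrightarrow> s b = h b"
      using linear_independent_extend[OF ind, of h] by blast
    \<comment> \<open>Since \<open>s\<close> transports coordinates along \<open>h\<close>, it maps the vectors whose \<open>e\<close>-coordinate satisfies a
      condition onto those whose \<open>e'\<close>-coordinate does. This settles \<open>L\<close> and \<open>M\<close> together.\<close>
    have image: "s (int_comb E c) = int_comb E' (c \<circ> inv_into E h)" for c
    proof -
      have "int_comb E c = int_comb E (c \<circ> inv_into E h \<circ> h)"
        unfolding int_comb_def
        using h by (intro sum.cong) (auto simp: bij_betw_def)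
      then show ?thesis using linear_image_int_comb[OF s h] by metis
    qed
    have "inv_into E h e' = e" using h he E(2) by (metis bij_betw_inv_into_left)
    then have img: "s ` int_comb E ` {c. P (c e)} = int_comb E' ` {c. P (c e')}" for P
    proof (intro equalityI subsetI)
      fix y assume "y \<in> s ` int_comb E ` {c. P (c e)}"
      then show "y \<in> int_comb E' ` {c. P (c e')}"
        using \<open>inv_into E h e' = e\<close> by (auto simp: image)
    next
      fix y assume "y \<in> int_comb E' ` {c. P (c e')}"
      then obtain c where "y = s (int_comb E (c \<circ> h))" "P ((c \<circ> h) e)"
        using linear_image_int_comb[OF s h] he by auto
      then show "y \<in> s ` int_comb E ` {c. P (c e)}" by blast
    qed
    have "L = s ` L" using img[of "\<lambda>_. True"] L by simp
    moreover have "N = s ` M" using img[of "\<lambda>k. m dvd k"] ME NE by simp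
    ultimately show ?thesis using s(1) unfolding unimodular_equivalent_def by blast
  qed
qed

end
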